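(* Let $P: M_n(\mathbb{C})\to M_n(\mathbb{C})$ be a Rota-Baxter operator of weight $\lambda\in\mathbb{R}$ such that $CB_P$ is invertible, and consider the reduced dynamics $$x(k+1)=\bar A x(k)+\bar A_d x(k-\tau)+\bar D\delta(k),\qquad k\ge 0,$$ with $\bar A=\Pi A_P$, $\bar A_d=\Pi A_{d,P}$, $\bar D=\Pi D$, $\Pi=I-B_P(CB_P)^{-1}C$. Let $X=X^\top>0$, $Y=Y^\top>0$ (real $n\times n$ matrices) and $\gamma>0$. The following statements are equivalent: (i) $$\begin{bmatrix} -X+Y & 0 & 0 & \bar A^\top\\ 0&-Y&0&\bar A_d^\top\\ 0&0&-\gamma^2 I&\bar D^\top\\ \bar A&\bar A_d&\bar D&-X^{-1}\end{bmatrix}<0.$$ (ii) $$\mathcal M:=\begin{bmatrix}\bar A^\top X\bar A-X+Y & \bar A^\top X\bar A_d & \bar A^\top X\bar D\\ \bar A_d^\top X\bar A & \bar A_d^\top X\bar A_d-Y & \bar A_d^\top X\bar D\\ \bar D^\top X\bar A & \bar D^\top X\bar A_d & \bar D^\top X\bar D-\gamma^2 I\end{bmatrix}<0.$$ If either condition holds, then, with $V_k=x(k)^\top Xx(k)+\sum_{i=1}^{\tau}x(k-i)^\top Yx(k-i)$ and $\Delta V_k=V_{k+1}-V_k$: (a) The reduced dynamics are asymptotically stable for $\delta\equiv 0$. More precisely, the leading $2n\times 2n$ principal submatrix $\mathcal M_0$ of $\mathcal M$ satisfies $\mathcal M_0<0$, so $\mu_0:=\lambda_{\min}(-\mathcal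 M_0)>0$, and $\Delta V_k\le-\mu_0\|x(k)\|^2$ for all $k$ along trajectories with $\delta\equiv 0$. (b) The reduced dynamics have bounded $\mathcal L_2$-gain from $\delta$ to $x$: with $\mu:=\lambda_{\min}(-\mathcal M)>0$, for all $N\ge 0$ and all bounded disturbances $\delta$, $$\sum_{k=0}^{N}\|x(k)\|^2\le\frac1\mu\Bigl(V_0+\gamma^2\sum_{k=0}^{N}\|\delta(k)\|^2\Bigr).$$ In particular, under zero extended initial conditions $x(0)=x(-1)=\dots=x(-\tau)=0$ (i.e. $V_0=0$), the effective $\mathcal L_2$-gain from $\delta$ to $x$ is $\gamma/\sqrt\mu$, in the sense of this bound.
   Context: A Rota-Baxter operator of weight $\lambda$ on an algebra $\mathcal A$ is a linear map $P:\mathcal A\to\mathcal A$ with $P(x)P(y)=P(xP(y))+P(P(x)y)+\lambda P(xy)$ for all $x,y\in\mathcal A$. Standing setting: $n=m=p$; $A,A_d\in\mathbb{R}^{n\times n}$, $B\in\mathbb{R}^{n\times m}$, $C\in\mathbb{R}^{m\times n}$, $D\in\mathbb{R}^{n\times p}$; $\tau\in\mathbb{N}$ is a known delay; $x(k)\in\mathbb{R}^n$ is the state and $\delta(k)\in\mathbb{R}^p$ a bounded disturbance. The deformed matrices are $A_P:=P(A)$, $A_{d,P}:=P(A_d)$, $B_P:=P(B)$, taken to be real. For a symmetric matrix $S$, $S<0$ means negative definite, and $\lambda_{\min}$ denotes the smallest eigenvalue. $\|\cdot\|$ on vectors is the Euclidean norm. The $2n\times 2n$ leading submatrix $\mathcal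 M_0$ is obtained from $\mathcal M$ by deleting the last block row and block column (those corresponding to $\delta$). *)

theory Defs
  imports "HOL-Analysis.Analysis"
begin

definition rota_baxter_operator ::
  "('k::field \<Rightarrow> 'a::ab_group_add \<Rightarrow> 'a) \<Rightarrow> ('a \<Rightarrow> 'a \<Rightarrow> 'a) \<Rightarrow> 'k \<Rightarrow> ('a \<Rightarrow> 'a) \<Rightarrow> bool"
  where "rota_baxter_operator s mul lam P \<longleftrightarrow>
    Vector_Spaces.linear s s P \<and>
    (\<forall>x y. mul (P x) (P y) =
       P (mul x (P y)) + P (mul (P x) y) + s lam (P (mul x y)))"

(* Scalar multiplication of matrices; the library's *s acts on vectors only, and
   *\<^sub>R gives only the real scalars on complex matrices. *)
definition mat_scale :: "'a::times \<Rightarrow> 'a^'n^'m \<Rightarrow> 'a^'n^'m"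
  where "mat_scale c = map_matrix ((*) c)"

definition hcat :: "'a^'c^'r \<Rightarrow> 'a^'d^'r \<Rightarrow> 'a^('c+'d)^'r"  (infixl \<open>|||\<close> 60)
  where "M ||| N = (\<chi> i j. case j of Inl a \<Rightarrow> M $ i $ a | Inr b \<Rightarrow> N $ i $ b)"

definition vcat :: "'a^'c^'r \<Rightarrow> 'a^'c^'s \<Rightarrow> 'a^'c^('r+'s)"  (infixl \<open>'/'/'/\<close> 55)
  where "vcat M N = (\<chi> i. case i of Inl a \<Rightarrow> M $ a | Inr b \<Rightarrow> N $ b)"

(* Block matrices associate to the left, so for a 3 x 3 block matrix over index type
   ('n+'n)+'n this deletes exactly the last block row and the last block column. *)
definition leading_submatrix :: "'a^('c::finite+'d::finite)^('c+'d) \<Rightarrow> 'a^'c^'c"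
  where "leading_submatrix M = (\<chi> i j. M $ Inl i $ Inl j)"

definition pos_def :: "real^'n^'n \<Rightarrow> bool"
  where "pos_def S \<longleftrightarrow> transpose S = S \<and> (\<forall>v. v \<noteq> 0 \<longrightarrow> v \<bullet> (S *v v) > 0)"

definition neg_def :: "real^'n^'n \<Rightarrow> bool"
  where "neg_def S \<longleftrightarrow> transpose S = S \<and> (\<forall>v. v \<noteq> 0 \<longrightarrow> v \<bullet> (S *v v) < 0)"

definition is_eigenvalue :: "real^'n^'n \<Rightarrow> real \<Rightarrow> bool"
  where "is_eigenvalue S l \<longleftrightarrow> (\<exists>v. v \<noteq> 0 \<and> S *v v = l *\<^sub>R v)"

(* Only meaningful when S has a real eigenvalue, e.g. when S is symmetric. *)
definition lambda_min :: "real^'n^'n \<Rightarrow> real"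
  where "lambda_min S = (LEAST l. is_eigenvalue S l)"

definition reduction_matrix :: "real^'n^'n \<Rightarrow> real^'n^'n \<Rightarrow> real^'n^'n"
  where "reduction_matrix C BP = mat 1 - BP ** matrix_inv (C ** BP) ** C"

(* States are indexed by int so that the extended initial condition
   x(-tau), ..., x(0) is part of x; values of x before -tau play no role. *)
definition trajectory ::
  "real^'n^'n \<Rightarrow> real^'n^'n \<Rightarrow> real^'p^'n \<Rightarrow> nat \<Rightarrow> (nat \<Rightarrow> real^'p) \<Rightarrow> (int \<Rightarrow> real^'n) \<Rightarrow> bool"
  where "trajectory A Ad D tau delta x \<longleftrightarrow>
    (\<forall>k::nat. x (int k + 1) = A *v x (int k) + Ad *v x (int k - int tau) + D *v delta k)"

(* Lyapunov stability of the zero solution, with respect to the extended initial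
   condition, and convergence of every trajectory; as the dynamics are linear,
   local and global attractivity coincide. *)
definition asymptotically_stable ::
  "real^'n^'n \<Rightarrow> real^'n^'n \<Rightarrow> real^'p^'n \<Rightarrow> nat \<Rightarrow> bool"
  where "asymptotically_stable A Ad D tau \<longleftrightarrow>
    (\<forall>e>0. \<exists>d>0. \<forall>x. trajectory A Ad D tau (\<lambda>_. 0) x \<longrightarrow>
        (\<forall>i\<le>tau. norm (x (- int i)) < d) \<longrightarrow> (\<forall>k::nat. norm (x (int k)) < e)) \<and>
    (\<forall>x. trajectory A Ad D tau (\<lambda>_. 0) x \<longrightarrow> (\<lambda>k::nat. x (int k)) \<longlonglongrightarrow> 0)"

definition lyapunov_krasovskii ::
  "real^'n^'n \<Rightarrow> real^'n^'n \<Rightarrow> nat \<Rightarrow> (int \<Rightarrow> real^'n) \<Rightarrow> nat \<Rightarrow> real"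
  where "lyapunov_krasovskii X Y tau x k =
    x (int k) \<bullet> (X *v x (int k)) +
    (\<Sum>i=1..tau. x (int k - int i) \<bullet> (Y *v x (int k - int i)))"

end

theory Submission
  imports Defs
begin

text \<open>
  Write $Q = \mathrm{diag}(Y - X, -Y, -\gamma^2 I)$ and $G = [\bar A\ \bar A_d\ \bar D]$.  Then
  $\mathcal M = Q + G^T X G$, and the matrix in (i) is $Q$ bordered by $G^T$, $G$ and $-X^{-1}$, so
  that $\mathcal M$ is its Schur complement.  Hence (i) and (ii) are equivalent
  (\<open>schur_complement_neg_def\<close>).

  The matrix $\mathcal M$ is also the matrix of a dissipation inequality.  In $V_{k+1} - V_k$ the delay
  sum telescopes to $x(k)^T Y x(k) - x(k-\tau)^T Y x(k-\tau)$, so for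
  $\xi_k = (x(k), x(k-\tau), \delta(k))$ every trajectory satisfies
  $\Delta V_k = \xi_k^T \mathcal M \xi_k + \gamma^2 \|\delta(k)\|^2$ (\<open>dissipation\<close>).
  If $\mathcal M < 0$, Rayleigh's bound (\<open>symmetric_lambda_min\<close>) gives
  $\xi_k^T \mathcal M \xi_k \<le> -\mu \|\xi_k\|^2 \<le> -\mu \|x(k)\|^2$; summing over $k$ and
  dropping $V_{N+1} \<ge> 0$ yields the gain bound (\<open>energy_bound\<close>).  For $\delta = 0$ the last
  component of $\xi_k$ is zero, so $\mathcal M_0$ with its own constant $\mu_0$ takes the place of
  $\mathcal M$, and Lyapunov's argument gives asymptotic stability
  (\<open>asymptotically_stable_if_decrease\<close>).
\<close>

section \<open>Block vectors and block matrices\<close>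

definition vec_append :: "'a^'c \<Rightarrow> 'a^'d \<Rightarrow> 'a^('c+'d)"  (infixl \<open>@@\<close> 60)
  where "u @@ w = (\<chi> i. case i of Inl a \<Rightarrow> u $ a | Inr b \<Rightarrow> w $ b)"

lemma vec_append_nth [simp]: "(u @@ w) $ Inl a = u $ a" "(u @@ w) $ Inr b = w $ b"
  by (simp_all add: vec_append_def)

lemma vec_append_exhaust:
  obtains u w where "v = u @@ w"
proof
  show "v = (\<chi> a. v $ Inl a) @@ (\<chi> b. v $ Inr b)"
    by (simp add: vec_append_def vec_eq_iff split: sum.split)
qed

lemma vec_append_eq_0_iff: "u @@ w = 0 \<longleftrightarrow> u = 0 \<and> w = 0"
  by (auto simp: vec_append_def vec_eq_iff split: sum.splits)

lemma sum_UNIV_Plus: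
  fixes f :: "'c::finite + 'd::finite \<Rightarrow> 'a::comm_monoid_add"
  shows "sum f UNIV = (\<Sum>a\<in>UNIV. f (Inl a)) + (\<Sum>b\<in>UNIV. f (Inr b))"
  by (simp add: UNIV_Plus_UNIV[symmetric] sum.Plus o_def del: UNIV_Plus_UNIV)

lemma inner_vec_append:
  fixes u u' :: "real^'c" and w w' :: "real^'d"
  shows "(u @@ w) \<bullet> (u' @@ w') = u \<bullet> u' + w \<bullet> w'"
  by (simp add: inner_vec_def sum_UNIV_Plus)

lemma norm_vec_append:
  fixes u :: "real^'c" and w :: "real^'d"
  shows "(norm (u @@ w))\<^sup>2 = (norm u)\<^sup>2 + (norm w)\<^sup>2"
  by (simp add: power2_norm_eq_inner inner_vec_append)

lemma hcat_nth [simp]: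
  "(M ||| N) $ i $ Inl a = M $ i $ a" "(M ||| N) $ i $ Inr b = N $ i $ b"
  by (simp_all add: hcat_def)

lemma vcat_nth [simp]: "(M /// N) $ Inl a = M $ a" "(M /// N) $ Inr b = N $ b"
  by (simp_all add: vcat_def)

lemma vcat_mult_vec: "(M /// N) *v v = M *v v @@ N *v v"
  for v :: "'a::semiring_1^'c"
  by (simp add: vec_eq_iff split_sum_all matrix_vector_mult_def)

lemma hcat_mult_vec_append: "(M ||| N) *v (u @@ w) = M *v u + N *v w"
  for M :: "'a::semiring_1^'c^'r" and N :: "'a^'d^'r"
  by (simp add: vec_eq_iff matrix_vector_mult_def sum_UNIV_Plus)

lemma vcat_mult: "(M /// N) ** K = M ** K /// N ** K"
  for K :: "'a::semiring_1^'c^'d"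
  by (simp add: vec_eq_iff split_sum_all matrix_matrix_mult_def)

lemma mult_hcat: "K ** (M ||| N) = K ** M ||| K ** N"
  for K :: "'a::semiring_1^'c^'d"
  by (simp add: vec_eq_iff split_sum_all matrix_matrix_mult_def)

lemma transpose_hcat: "transpose (M ||| N) = transpose M /// transpose N"
  by (simp add: vec_eq_iff split_sum_all transpose_def)

lemma transpose_vcat: "transpose (M /// N) = transpose M ||| transpose N"
  by (simp add: vec_eq_iff split_sum_all transpose_def)

lemma vcat_hcat_interchange: "(M ||| N) /// (M' ||| N') = (M /// M') ||| (N /// N')"
  by (simp add: vec_eq_iff split_sum_all)

lemma vcat_add: "(M /// N) + (M' /// N') = (M + M' /// N + N')"
  for M :: "'a::plus^'c^'r"
  by (simp add: vec_eq_iff split_sum_all)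

lemma hcat_add: "(M ||| N) + (M' ||| N') = (M + M' ||| N + N')"
  for M :: "'a::plus^'c^'r"
  by (simp add: vec_eq_iff split_sum_all)

section \<open>Definite matrices and their smallest eigenvalue\<close>

lemma matrix_vector_mult_uminus: "(- S) *v v = - (S *v v)" for S :: "real^'n^'m"
  using matrix_vector_mult_diff_rdistrib[of 0 S v] by simp

lemma neg_def_iff_pos_def_uminus: "neg_def S \<longleftrightarrow> pos_def (- S)"
  by (simp add: neg_def_def pos_def_def matrix_vector_mult_uminus)
    (simp add: transpose_def vec_eq_iff)

lemma symmetric_inner: "transpose S = S \<Longrightarrow> u \<bullet> (S *v w) = (S *v u) \<bullet> w"
  for S :: "real^'n^'n"
  by (metis dot_lmul_matrix vector_transpose_matrix)

text \<open>A nonnegative quadratic form vanishes at $u$ only if $u$ lies in the kernel of its matrix: it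
  is minimal there, so its gradient vanishes.  The gradient is extracted by moving from $u$ a short
  way against $S u$.\<close>

lemma nonneg_form_zero_imp_kernel:
  fixes S :: "real^'n^'n"
  assumes sym: "transpose S = S" and nonneg: "\<And>v. v \<bullet> (S *v v) \<ge> 0" and zero: "u \<bullet> (S *v u) = 0"
  shows "S *v u = 0"
proof (rule ccontr)
  assume nz: "S *v u \<noteq> 0"
  define w where "w = S *v u"
  define q where "q = w \<bullet> (S *v w)"
  have ww: "w \<bullet> w > 0" using nz by (simp add: w_def)
  have q0: "q \<ge> 0" using nonneg by (simp add: q_def)
  \<comment> \<open>Minimizing the quadratic in $t$ exactly would divide by $q$, which may be 0; $q + 1$ avoids this.\<close>
  define t where "t = - (w \<bullet> w) / (q + 1)"
  have t: "t < 0" using ww q0 by (simp add: t_def)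
  have uw: "u \<bullet> (S *v w) = w \<bullet> w" using symmetric_inner[OF sym, of u w] by (simp add: w_def)
  have "(u + t *\<^sub>R w) \<bullet> (S *v (u + t *\<^sub>R w)) = 2 * t * (w \<bullet> w) + t\<^sup>2 * q"
    using zero uw
    by (simp add: matrix_vector_right_distrib matrix_vector_mult_scaleR inner_add_left
        inner_add_right w_def[symmetric] q_def algebra_simps power2_eq_square)
  hence "0 \<le> t * (2 * (w \<bullet> w) + t * q)"
    using nonneg[of "u + t *\<^sub>R w"] by (simp add: algebra_simps power2_eq_square)
  moreover have "w \<bullet> w + t * q = (w \<bullet> w) / (q + 1)"
    using q0 by (simp add: t_def field_simps)
  moreover have "(w \<bullet> w) / (q + 1) > 0" using ww q0 by simp
  ultimately have "2 * (w \<bullet> w) + t * q > 0" using ww by linarith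
  with t \<open>0 \<le> t * (2 * (w \<bullet> w) + t * q)\<close> show False
    by (meson mult_neg_pos not_le)
qed

text \<open>The minimum of the quadratic form over the unit sphere is attained by compactness, and the
  previous lemma, applied to the matrix shifted by this minimum, makes the minimizer an
  eigenvector.  No eigenvalue is smaller, since an eigenvalue is the value of the form at its
  normalized eigenvector.\<close>

lemma symmetric_lambda_min:
  fixes S :: "real^'n^'n"
  assumes sym: "transpose S = S"
  shows lambda_min_eigenvalue: "is_eigenvalue S (lambda_min S)"
    and lambda_min_le_form: "lambda_min S * (norm v)\<^sup>2 \<le> v \<bullet> (S *v v)"
proof -
  have "continuous_on (sphere 0 1) (\<lambda>v. v \<bullet> (S *v v))"
    by (intro continuous_intros linear_continuous_on matrix_vector_mul_bounded_linear)
  moreover have "sphere (0::real^'n) 1 \<noteq> {}" by simp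
  ultimately obtain u where u: "norm u = 1"
    and least: "\<And>v. norm v = 1 \<Longrightarrow> u \<bullet> (S *v u) \<le> v \<bullet> (S *v v)"
    using continuous_attains_inf[OF compact_sphere, of 0 1 "\<lambda>v. v \<bullet> (S *v v)"]
    by (auto simp: dist_norm)
  define l where "l = u \<bullet> (S *v u)"
  have bound: "l * (norm v)\<^sup>2 \<le> v \<bullet> (S *v v)" for v
  proof (cases "v = 0")
    case False
    have "l \<le> (v /\<^sub>R norm v) \<bullet> (S *v (v /\<^sub>R norm v))"
      unfolding l_def by (rule least) (use False in simp)
    also have "\<dots> = (v \<bullet> (S *v v)) / (norm v)\<^sup>2"
      by (simp add: matrix_vector_mult_scaleR power2_eq_square divide_inverse mult_ac)
    finally show ?thesis using False by (simp add: field_simps)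
  qed simp
  define T where "T = S - l *\<^sub>R mat 1"
  have T: "T *v v = S *v v - l *\<^sub>R v" for v
    by (simp add: T_def matrix_vector_mult_diff_rdistrib scaleR_matrix_vector_assoc[symmetric])
  have "T *v u = 0"
  proof (rule nonneg_form_zero_imp_kernel)
    show "transpose T = T"
      using sym by (auto simp: T_def transpose_def vec_eq_iff mat_def)
    show "v \<bullet> (T *v v) \<ge> 0" for v
      using bound[of v] by (simp add: T inner_diff_right power2_norm_eq_inner)
    show "u \<bullet> (T *v u) = 0"
      using u by (simp add: T inner_diff_right l_def power2_norm_eq_inner[symmetric])
  qed
  hence "S *v u = l *\<^sub>R u" by (simp add: T)
  with u have eig: "is_eigenvalue S l" by (auto simp: is_eigenvalue_def intro!: exI[of _ u])
  have "l \<le> m" if m: "is_eigenvalue S m" for m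
  proof -
    obtain v where "v \<noteq> 0" "S *v v = m *\<^sub>R v" using m by (auto simp: is_eigenvalue_def)
    thus ?thesis using bound[of v] by (simp add: power2_norm_eq_inner)
  qed
  with eig have "lambda_min S = l"
    unfolding lambda_min_def by (intro Least_equality) auto
  thus "is_eigenvalue S (lambda_min S)" "lambda_min S * (norm v)\<^sup>2 \<le> v \<bullet> (S *v v)"
    using eig bound by simp_all
qed

lemma pos_def_lambda_min_pos:
  assumes "pos_def S"
  shows "lambda_min S > 0"
proof -
  obtain v where v: "v \<noteq> 0" "S *v v = lambda_min S *\<^sub>R v"
    using lambda_min_eigenvalue[of S] assms by (auto simp: pos_def_def is_eigenvalue_def)
  hence "lambda_min S * (v \<bullet> v) > 0" using assms by (metis pos_def_def inner_scaleR_right)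
  moreover have "v \<bullet> v > 0" using v by simp
  ultimately show ?thesis by (meson zero_less_mult_pos2)
qed

lemma pos_def_form_ge:
  "pos_def S \<Longrightarrow> lambda_min S * (norm v)\<^sup>2 \<le> v \<bullet> (S *v v)"
  by (simp add: pos_def_def lambda_min_le_form)

lemma pos_def_form_nonneg: "pos_def S \<Longrightarrow> 0 \<le> v \<bullet> (S *v v)"
  by (cases "v = 0") (auto simp: pos_def_def intro: less_imp_le)

lemma pos_def_form_eq_0_iff: "pos_def S \<Longrightarrow> v \<bullet> (S *v v) = 0 \<longleftrightarrow> v = 0"
  by (cases "v = 0") (auto simp: pos_def_def dest: spec[of _ v])

lemma neg_def_form_le:
  "neg_def S \<Longrightarrow> v \<bullet> (S *v v) \<le> - lambda_min (- S) * (norm v)\<^sup>2"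
  using pos_def_form_ge[of "- S" v]
  by (simp add: neg_def_iff_pos_def_uminus matrix_vector_mult_uminus)

lemma form_le_onorm: "v \<bullet> (S *v v) \<le> onorm ((*v) S) * (norm v)\<^sup>2"
  for S :: "real^'n^'n"
proof -
  have "v \<bullet> (S *v v) \<le> norm v * norm (S *v v)" by (rule norm_cauchy_schwarz)
  also have "\<dots> \<le> norm v * (onorm ((*v) S) * norm v)"
    by (intro mult_left_mono onorm matrix_vector_mul_bounded_linear) auto
  finally show ?thesis by (simp add: power2_eq_square mult_ac)
qed

lemma pos_def_matrix_inv:
  fixes X :: "real^'n^'n"
  assumes X: "pos_def X"
  shows "X ** matrix_inv X = mat 1" "matrix_inv X ** X = mat 1" "pos_def (matrix_inv X)"
proof -
  have "v = 0" if "X *v v = 0" for v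
    using that pos_def_form_eq_0_iff[OF X, of v] by simp
  hence "invertible X"
    using matrix_left_invertible_ker[of X] invertible_left_inverse[of X] by blast
  hence "X ** matrix_inv X = mat 1 \<and> matrix_inv X ** X = mat 1"
    unfolding invertible_def matrix_inv_def by (rule someI_ex)
  thus inv: "X ** matrix_inv X = mat 1" "matrix_inv X ** X = mat 1" by simp_all
  have sym: "transpose X = X" using X by (simp add: pos_def_def)
  have "transpose (matrix_inv X) ** X = mat 1"
    using inv(1) sym by (metis matrix_transpose_mul transpose_mat)
  hence symi: "transpose (matrix_inv X) = matrix_inv X"
    using inv by (metis matrix_mul_assoc matrix_mul_lid matrix_mul_rid)
  have "v \<bullet> (matrix_inv X *v v) > 0" if "v \<noteq> 0" for v
  proof -
    define w where "w = matrix_inv X *v v"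
    have v: "v = X *v w" using inv by (simp add: w_def matrix_vector_mul_assoc)
    with that have "w \<noteq> 0" by auto
    thus ?thesis using X v by (metis w_def pos_def_def inner_commute)
  qed
  thus "pos_def (matrix_inv X)" using symi by (simp add: pos_def_def)
qed

text \<open>Padding with zeros identifies the form of the leading submatrix with a restriction of the
  full form.\<close>

lemma neg_def_leading_submatrix:
  fixes M :: "real^('c::finite+'d::finite)^('c+'d)"
  assumes "neg_def M"
  shows "neg_def (leading_submatrix M)"
    and "v \<bullet> (leading_submatrix M *v v) = (v @@ 0) \<bullet> (M *v (v @@ 0))"
proof -
  show form: "v \<bullet> (leading_submatrix M *v v) = (v @@ 0) \<bullet> (M *v (v @@ 0))" for v
    by (simp add: inner_vec_def sum_UNIV_Plus matrix_vector_mult_def leading_submatrix_def)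
  have "transpose (leading_submatrix M) = leading_submatrix M"
    using assms by (simp add: neg_def_def transpose_def leading_submatrix_def vec_eq_iff)
  thus "neg_def (leading_submatrix M)"
    using assms by (simp add: neg_def_def form vec_append_eq_0_iff)
qed

section \<open>The Schur complement\<close>

text \<open>Completing the square: the left-hand side expands to
  $a \<bullet> Q a + 2\, b \<bullet> G a - b \<bullet> X^{-1} b$, and $X G a$ is the maximizer in $b$.\<close>

lemma schur_square:
  fixes Q :: "real^'m^'m" and G :: "real^'m^'n" and X :: "real^'n^'n" and a b
  assumes X: "pos_def X"
  defines "d \<equiv> b - X *v (G *v a)"
  shows "(a @@ b) \<bullet> (((Q ||| transpose G) /// (G ||| - matrix_inv X)) *v (a @@ b)) =
    a \<bullet> ((Q + transpose G ** X ** G) *v a) - d \<bullet> (matrix_inv X *v d)"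
proof -
  define g where "g = G *v a"
  note inv = pos_def_matrix_inv[OF X]
  have tr: "a \<bullet> (w v* G) = g \<bullet> w" for w
    unfolding g_def by (metis dot_lmul_matrix inner_commute)
  have XX: "matrix_inv X *v (X *v g) = g"
    using inv by (simp add: matrix_vector_mul_assoc)
  have "(X *v g) \<bullet> (matrix_inv X *v b) = g \<bullet> b"
    using symmetric_inner[of "matrix_inv X" "X *v g" b] inv(3) XX by (simp add: pos_def_def)
  hence "d \<bullet> (matrix_inv X *v d) = b \<bullet> (matrix_inv X *v b) - 2 * (b \<bullet> g) + g \<bullet> (X *v g)"
    by (simp add: d_def g_def[symmetric] matrix_vector_mult_diff_distrib inner_diff_left
        inner_diff_right XX inner_commute)
  thus ?thesis
    by (simp add: vcat_mult_vec hcat_mult_vec_append inner_vec_append tr inner_add_right inner_diff_right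
        matrix_vector_mult_add_rdistrib matrix_vector_mult_uminus g_def[symmetric]
        matrix_vector_mul_assoc[symmetric] inner_commute)
qed

lemma schur_complement_neg_def:
  fixes Q :: "real^'m^'m" and G :: "real^'m^'n" and X :: "real^'n^'n"
  assumes X: "pos_def X" and Q: "transpose Q = Q"
  shows "neg_def ((Q ||| transpose G) /// (G ||| - matrix_inv X)) \<longleftrightarrow>
    neg_def (Q + transpose G ** X ** G)" (is "neg_def ?L \<longleftrightarrow> neg_def ?S")
proof -
  note inv = pos_def_matrix_inv(3)[OF X]
  have add: "transpose (K + N) = transpose K + transpose N" for K N :: "real^'m^'m"
    by (simp add: transpose_def vec_eq_iff)
  have neg: "transpose (- K) = - transpose K" for K :: "real^'n^'n"
    by (simp add: transpose_def vec_eq_iff)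
  have symS: "transpose ?S = ?S"
    using X Q by (simp add: add matrix_transpose_mul matrix_mul_assoc pos_def_def)
  have symL: "transpose ?L = ?L"
    using inv Q by (simp add: transpose_hcat transpose_vcat vcat_hcat_interchange neg pos_def_def)
  note sq = schur_square[OF X, where Q = Q and G = G]
  show ?thesis
  proof
    assume L: "neg_def ?L"
    have "a \<bullet> (?S *v a) < 0" if "a \<noteq> 0" for a
    proof -
      \<comment> \<open>This choice of the second component makes the subtracted square vanish.\<close>
      define v where "v = a @@ X *v (G *v a)"
      have "v \<noteq> 0" using that by (simp add: v_def vec_append_eq_0_iff)
      hence "v \<bullet> (?L *v v) < 0" using L by (simp add: neg_def_def)
      thus ?thesis unfolding v_def by (subst (asm) sq) simp
    qed
    thus "neg_def ?S" using symS by (simp add: neg_def_def)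
  next
    assume S: "neg_def ?S"
    have "v \<bullet> (?L *v v) < 0" if nz: "v \<noteq> 0" for v
    proof -
      obtain a b where v: "v = a @@ b" by (rule vec_append_exhaust)
      define d where "d = b - X *v (G *v a)"
      have eq: "v \<bullet> (?L *v v) = a \<bullet> (?S *v a) - d \<bullet> (matrix_inv X *v d)"
        unfolding v d_def by (rule sq)
      show ?thesis
      proof (cases "a = 0")
        case True
        hence "d \<noteq> 0" using nz by (simp add: d_def v vec_append_eq_0_iff)
        with True eq inv show ?thesis by (simp add: pos_def_def)
      next
        case False
        hence "a \<bullet> (?S *v a) < 0" using S by (simp add: neg_def_def)
        with eq pos_def_form_nonneg[OF inv, of d] show ?thesis by simp
      qed
    qed
    thus "neg_def ?L" using symL by (simp add: neg_def_def)
  qed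
qed

section \<open>The two matrices of the inequality\<close>

text \<open>The part $Q = \mathrm{diag}(Y - X, -Y, -g^2 I)$ of $\mathcal M$ that does not involve the
  dynamics.\<close>

definition supply_matrix ::
    "real^'n^'n \<Rightarrow> real^'n^'n \<Rightarrow> real \<Rightarrow> real^(('n::finite+'n)+'p::finite)^(('n+'n)+'p)"
  where "supply_matrix X Y g =
    (- X + Y ||| 0 ||| 0) /// (0 ||| - Y ||| 0) /// (0 ||| 0 ||| - (g\<^sup>2 *\<^sub>R mat 1))"

lemma transpose_supply_matrix:
  assumes "transpose X = X" "transpose Y = Y"
  shows "transpose (supply_matrix X Y g) = supply_matrix X Y g"
proof -
  have "X $ i $ j = X $ j $ i" "Y $ i $ j = Y $ j $ i" for i j
    using assms by (metis transpose_def vec_lambda_beta)+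
  thus ?thesis
    by (simp add: supply_matrix_def transpose_def vec_eq_iff split_sum_all mat_def eq_commute)
qed

lemma block_matrix_eq_supply:
  fixes A Ad :: "real^'n^'n" and D :: "real^'p^'n"
  shows "(transpose A ** X ** A - X + Y ||| transpose A ** X ** Ad ||| transpose A ** X ** D)
    /// (transpose Ad ** X ** A ||| transpose Ad ** X ** Ad - Y ||| transpose Ad ** X ** D)
    /// (transpose D ** X ** A ||| transpose D ** X ** Ad ||| transpose D ** X ** D - g\<^sup>2 *\<^sub>R mat 1)
    = supply_matrix X Y g + transpose (A ||| Ad ||| D) ** X ** (A ||| Ad ||| D)"
  by (simp add: supply_matrix_def transpose_hcat vcat_mult mult_hcat vcat_hcat_interchange
      vcat_add hcat_add algebra_simps)

lemma bordered_matrix_eq_supply: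
  fixes A Ad :: "real^'n^'n" and D :: "real^'p^'n"
  shows "(- X + Y ||| 0 ||| 0 ||| transpose A)
      /// (0 ||| - Y ||| 0 ||| transpose Ad)
      /// (0 ||| 0 ||| - (g\<^sup>2 *\<^sub>R mat 1) ||| transpose D)
      /// (A ||| Ad ||| D ||| K)
    = (supply_matrix X Y g ||| transpose (A ||| Ad ||| D)) /// (A ||| Ad ||| D ||| K)"
  by (simp add: supply_matrix_def transpose_hcat vcat_hcat_interchange)

text \<open>With $z = x(k+1)$ the successor state, $\mathcal M$ represents the one-step change of $V$ less
  the supplied energy $g^2 \|d\|^2$: the term $G^T X G$ contributes $z^T X z$, and the
  block-diagonal part contributes the rest.\<close>

lemma supply_form:
  fixes A Ad :: "real^'n^'n" and D :: "real^'p^'n"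
  assumes "z = A *v x + Ad *v y + D *v d"
  shows "(x @@ y @@ d) \<bullet> ((supply_matrix X Y g + transpose (A ||| Ad ||| D) ** X ** (A ||| Ad ||| D))
      *v (x @@ y @@ d)) =
    z \<bullet> (X *v z) - x \<bullet> (X *v x) + x \<bullet> (Y *v x) - y \<bullet> (Y *v y) - g\<^sup>2 * (norm d)\<^sup>2"
proof -
  have G: "(A ||| Ad ||| D) *v (x @@ y @@ d) = z"
    by (simp add: assms hcat_mult_vec_append)
  have "v \<bullet> (transpose H *v w) = (H *v v) \<bullet> w" for H :: "real^(('n+'n)+'p)^'n" and v w
    by (metis dot_lmul_matrix transpose_matrix_vector inner_commute)
  moreover have "supply_matrix X Y g *v (x @@ y @@ d) =
      (- (X *v x) + Y *v x) @@ - (Y *v y) @@ - (g\<^sup>2 *\<^sub>R d)"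
    by (simp add: supply_matrix_def vcat_mult_vec hcat_mult_vec_append matrix_vector_mult_uminus
        matrix_vector_mult_add_rdistrib matrix_vector_mult_diff_rdistrib
        scaleR_matrix_vector_assoc[symmetric])
  ultimately show ?thesis
    by (simp add: matrix_vector_mult_add_rdistrib matrix_vector_mul_assoc[symmetric] G
        inner_add_right inner_vec_append power2_norm_eq_inner inner_diff_right)
qed

section \<open>Dissipation along trajectories\<close>

text \<open>Passing from $k$ to $k+1$ shifts the window of the delay sum by one, so that only its new
  first term and its old last term survive.\<close>

lemma lyapunov_krasovskii_step:
  "lyapunov_krasovskii X Y tau x (k + 1) - lyapunov_krasovskii X Y tau x k =
    x (int k + 1) \<bullet> (X *v x (int k + 1)) - x (int k) \<bullet> (X *v x (int k))
    + x (int k) \<bullet> (Y *v x (int k)) - x (int k - int tau) \<bullet> (Y *v x (int k - int tau))"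
proof -
  define f where "f i = x (int k - int i) \<bullet> (Y *v x (int k - int i))" for i :: nat
  have "(\<Sum>i=1..tau. x (int (k + 1) - int i) \<bullet> (Y *v x (int (k + 1) - int i))) = (\<Sum>i<tau. f i)"
    unfolding f_def by (rule sum.reindex_bij_witness[of _ Suc "\<lambda>i. i - 1"]) (auto simp: algebra_simps)
  moreover have "(\<Sum>i=1..tau. f i) = (\<Sum>i<tau. f (Suc i))"
    by (rule sum.reindex_bij_witness[of _ Suc "\<lambda>i. i - 1"]) auto
  moreover have "(\<Sum>i<tau. f (Suc i)) = (\<Sum>i<tau. f i) + f tau - f 0"
    using sum_lessThan_telescope[of f tau] by (simp add: sum_subtractf)
  ultimately show ?thesis
    by (simp add: lyapunov_krasovskii_def f_def add.commute)
qed

lemma lyapunov_krasovskii_nonneg: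
  "pos_def X \<Longrightarrow> pos_def Y \<Longrightarrow> 0 \<le> lyapunov_krasovskii X Y tau x k"
  by (simp add: lyapunov_krasovskii_def pos_def_form_nonneg sum_nonneg)

lemma lyapunov_krasovskii_eq_0_iff:
  assumes "pos_def X" "pos_def Y"
  shows "lyapunov_krasovskii X Y tau x 0 = 0 \<longleftrightarrow> (\<forall>i\<le>tau. x (- int i) = 0)"
proof -
  have "lyapunov_krasovskii X Y tau x 0 = 0 \<longleftrightarrow> x 0 = 0 \<and> (\<forall>i\<in>{1..tau}. x (- int i) = 0)"
    using assms by (simp add: lyapunov_krasovskii_def add_nonneg_eq_0_iff pos_def_form_nonneg
        sum_nonneg sum_nonneg_eq_0_iff pos_def_form_eq_0_iff)
  also have "\<dots> \<longleftrightarrow> (\<forall>i\<le>tau. x (- int i) = 0)"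
    by (auto simp: Ball_def) (metis One_nat_def Suc_leI neq0_conv of_nat_0 neg_equal_zero)
  finally show ?thesis .
qed

lemma dissipation:
  fixes A Ad :: "real^'n^'n" and D :: "real^'p^'n"
  defines "M \<equiv> \<lambda>X Y g. supply_matrix X Y g + transpose (A ||| Ad ||| D) ** X ** (A ||| Ad ||| D)"
  assumes "trajectory A Ad D tau delta x"
  shows "lyapunov_krasovskii X Y tau x (k + 1) - lyapunov_krasovskii X Y tau x k =
    (x (int k) @@ x (int k - int tau) @@ delta k)
      \<bullet> (M X Y g *v (x (int k) @@ x (int k - int tau) @@ delta k)) + g\<^sup>2 * (norm (delta k))\<^sup>2"
proof -
  have "x (int k + 1) = A *v x (int k) + Ad *v x (int k - int tau) + D *v delta k"
    using assms by (simp add: trajectory_def)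
  from supply_form[OF this, of X Y g] show ?thesis
    unfolding M_def lyapunov_krasovskii_step by simp
qed

text \<open>The Lyapunov criterion, in discrete time.  Since $V$ does not increase and dominates
  $\lambda_{\min}(X) \|x(k)\|^2$, a small extended initial condition keeps the state small; since the
  decrements of $V$ add up to at most $V_0$, the squares $\|x(k)\|^2$ are summable and tend to $0$.\<close>

lemma asymptotically_stable_if_decrease:
  fixes A Ad X Y :: "real^'n^'n" and D :: "real^'p^'n"
  assumes X: "pos_def X" and Y: "pos_def Y" and m: "m > 0"
    and dec: "\<And>x k. trajectory A Ad D tau (\<lambda>_. 0) x \<Longrightarrow>
      lyapunov_krasovskii X Y tau x (k + 1) - lyapunov_krasovskii X Y tau x k \<le> - m * (norm (x (int k)))\<^sup>2"
  shows "asymptotically_stable A Ad D tau"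
proof -
  let ?V = "lyapunov_krasovskii X Y tau"
  have sums: "?V x k + m * (\<Sum>j<k. (norm (x (int j)))\<^sup>2) \<le> ?V x 0"
    if "trajectory A Ad D tau (\<lambda>_. 0) x" for x k
  proof (induction k)
    case (Suc k)
    with dec[OF that, of k] show ?case by (simp add: algebra_simps)
  qed simp
  define c where "c = lambda_min X"
  have c: "c > 0" using pos_def_lambda_min_pos[OF X] by (simp add: c_def)
  define K where "K = onorm ((*v) X) + real tau * onorm ((*v) Y) + 1"
  have on: "onorm ((*v) S) \<ge> 0" for S :: "real^'n^'n"
    by (intro onorm_pos_le matrix_vector_mul_bounded_linear)
  have K: "K > 0" unfolding K_def using on[of X] on[of Y]
    by (simp add: add_nonneg_pos)
  have V0: "?V x 0 \<le> K * d\<^sup>2" if d: "\<And>i. i \<le> tau \<Longrightarrow> norm (x (- int i)) < d" for x d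
  proof -
    have form: "x (- int i) \<bullet> (S *v x (- int i)) \<le> onorm ((*v) S) * d\<^sup>2"
      if "i \<le> tau" for S :: "real^'n^'n" and i
      using form_le_onorm[of "x (- int i)" S] d[OF that] on[of S]
      by (meson less_imp_le mult_left_mono norm_ge_zero order_trans power_mono)
    have "(\<Sum>i=1..tau. x (- int i) \<bullet> (Y *v x (- int i))) \<le> (\<Sum>i=1..tau. onorm ((*v) Y) * d\<^sup>2)"
      by (intro sum_mono form) auto
    moreover have "x 0 \<bullet> (X *v x 0) \<le> onorm ((*v) X) * d\<^sup>2" using form[of 0 X] by simp
    ultimately have "?V x 0 \<le> onorm ((*v) X) * d\<^sup>2 + real tau * (onorm ((*v) Y) * d\<^sup>2)"
      by (simp add: lyapunov_krasovskii_def)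
    also have "\<dots> \<le> K * d\<^sup>2" by (simp add: K_def algebra_simps)
    finally show ?thesis .
  qed
  have stable: "\<exists>d>0. \<forall>x. trajectory A Ad D tau (\<lambda>_. 0) x \<longrightarrow>
        (\<forall>i\<le>tau. norm (x (- int i)) < d) \<longrightarrow> (\<forall>k::nat. norm (x (int k)) < e)"
    if e: "e > 0" for e
  proof (intro exI[of _ "e * sqrt (c / K) / 2"] conjI allI impI)
    \<comment> \<open>Chosen so that \<open>K * ?d\<^sup>2 = c * (e / 2)\<^sup>2\<close>; the factor 2 makes the final inequality strict.\<close>
    let ?d = "e * sqrt (c / K) / 2"
    show "?d > 0" using e c K by simp
    fix x k assume tr: "trajectory A Ad D tau (\<lambda>_. 0) x" and small: "\<forall>i\<le>tau. norm (x (- int i)) < ?d"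
    have "c * (norm (x (int k)))\<^sup>2 \<le> x (int k) \<bullet> (X *v x (int k))"
      using pos_def_form_ge[OF X] by (simp add: c_def)
    also have "\<dots> \<le> ?V x k"
      by (simp add: lyapunov_krasovskii_def sum_nonneg pos_def_form_nonneg[OF Y])
    also have "\<dots> \<le> ?V x 0"
      using sums[OF tr, of k] m by (smt (verit) mult_nonneg_nonneg sum_nonneg zero_le_power2)
    also have "\<dots> \<le> K * ?d\<^sup>2" using V0 small by blast
    also have "\<dots> = c * (e / 2)\<^sup>2" using c K by (simp add: power_mult_distrib power_divide)
    finally have "(norm (x (int k)))\<^sup>2 \<le> (e / 2)\<^sup>2" using c by simp
    hence "norm (x (int k)) \<le> e / 2" using e by (simp add: power2_le_iff_abs_le)
    thus "norm (x (int k)) < e" using e by simp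
  qed
  have "(\<lambda>k::nat. x (int k)) \<longlonglongrightarrow> 0" if tr: "trajectory A Ad D tau (\<lambda>_. 0) x" for x
  proof -
    have "summable (\<lambda>k. (norm (x (int k)))\<^sup>2)"
    proof (rule summableI_nonneg_bounded)
      fix n
      have "m * (\<Sum>j<n. (norm (x (int j)))\<^sup>2) \<le> ?V x 0"
        using sums[OF tr, of n] lyapunov_krasovskii_nonneg[OF X Y, of tau x n] by linarith
      thus "(\<Sum>j<n. (norm (x (int j)))\<^sup>2) \<le> ?V x 0 / m" using m by (simp add: field_simps)
    qed simp
    hence "(\<lambda>k. (norm (x (int k)))\<^sup>2) \<longlonglongrightarrow> 0" by (rule summable_LIMSEQ_zero)
    hence "(\<lambda>k. sqrt ((norm (x (int k)))\<^sup>2)) \<longlonglongrightarrow> sqrt 0" by (rule tendsto_real_sqrt)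
    thus ?thesis by (simp add: tendsto_norm_zero_iff)
  qed
  with stable show ?thesis by (simp add: asymptotically_stable_def)
qed

text \<open>The dissipation inequalities add up to
  $V_{N+1} + m \sum \|x(k)\|^2 \<le> V_0 + g^2 \sum \|\delta(k)\|^2$, and $V_{N+1}$ is nonnegative.\<close>

lemma energy_bound:
  fixes A Ad X Y :: "real^'n^'n" and D :: "real^'p^'n"
  assumes X: "pos_def X" and Y: "pos_def Y" and m: "m > 0"
    and dec: "\<And>k. lyapunov_krasovskii X Y tau x (k + 1) - lyapunov_krasovskii X Y tau x k
      \<le> - m * (norm (x (int k)))\<^sup>2 + g\<^sup>2 * (norm (delta k))\<^sup>2"
  shows "(\<Sum>k\<le>N. (norm (x (int k)))\<^sup>2)
    \<le> 1 / m * (lyapunov_krasovskii X Y tau x 0 + g\<^sup>2 * (\<Sum>k\<le>N. (norm (delta k))\<^sup>2))"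
proof -
  let ?V = "lyapunov_krasovskii X Y tau x"
  have "?V n + m * (\<Sum>j<n. (norm (x (int j)))\<^sup>2) \<le> ?V 0 + g\<^sup>2 * (\<Sum>j<n. (norm (delta j))\<^sup>2)" for n
  proof (induction n)
    case (Suc n)
    with dec[of n] show ?case by (simp add: algebra_simps)
  qed simp
  from this[of "Suc N"] have "m * (\<Sum>k\<le>N. (norm (x (int k)))\<^sup>2)
      \<le> ?V 0 + g\<^sup>2 * (\<Sum>k\<le>N. (norm (delta k))\<^sup>2)"
    using lyapunov_krasovskii_nonneg[OF X Y, of tau x "Suc N"] unfolding lessThan_Suc_atMost
    by linarith
  thus ?thesis using m by (simp add: field_simps)
qed

section \<open>The bounded real lemma for the reduced dynamics\<close>

theorem theorem5p4:
  fixes P :: "complex^'n^'n \<Rightarrow> complex^'n^'n" and lam gamma :: real and tau :: nat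
    and A Ad B C D AP AdP BP Pr Abar Adbar Dbar X Y :: "real^'n^'n"
    and L :: "real^((('n+'n)+'n)+'n)^((('n+'n)+'n)+'n)"
    and V :: "(int \<Rightarrow> real^'n) \<Rightarrow> nat \<Rightarrow> real"
    and M :: "real^(('n+'n)+'n)^(('n+'n)+'n)"
  assumes rota_baxter: "rota_baxter_operator mat_scale (**) (complex_of_real lam) P"
    and AP: "P (map_matrix complex_of_real A) = map_matrix complex_of_real AP"
    and AdP: "P (map_matrix complex_of_real Ad) = map_matrix complex_of_real AdP"
    and BP: "P (map_matrix complex_of_real B) = map_matrix complex_of_real BP"
    and CBP: "invertible (C ** BP)"
    and Pr: "Pr = reduction_matrix C BP"
    and Abar: "Abar = Pr ** AP"
    and Adbar: "Adbar = Pr ** AdP"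
    and Dbar: "Dbar = Pr ** D"
    and X: "pos_def X"
    and Y: "pos_def Y"
    and gamma: "gamma > 0"
    and M: "M =
      (transpose Abar ** X ** Abar - X + Y ||| transpose Abar ** X ** Adbar ||| transpose Abar ** X ** Dbar)
      /// (transpose Adbar ** X ** Abar ||| transpose Adbar ** X ** Adbar - Y ||| transpose Adbar ** X ** Dbar)
      /// (transpose Dbar ** X ** Abar ||| transpose Dbar ** X ** Adbar ||| transpose Dbar ** X ** Dbar - gamma\<^sup>2 *\<^sub>R mat 1)"
    and L: "L =
      (- X + Y ||| 0 ||| 0 ||| transpose Abar)
      /// (0 ||| - Y ||| 0 ||| transpose Adbar)
      /// (0 ||| 0 ||| - (gamma\<^sup>2 *\<^sub>R mat 1) ||| transpose Dbar)
      /// (Abar ||| Adbar ||| Dbar ||| - matrix_inv X)"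
    and V: "V = lyapunov_krasovskii X Y tau"
  shows "(neg_def L \<longleftrightarrow> neg_def M) \<and>
    (neg_def L \<or> neg_def M \<longrightarrow>
      (let M0 = leading_submatrix M; mu0 = lambda_min (- M0) in
        asymptotically_stable Abar Adbar Dbar tau \<and>
        neg_def M0 \<and>
        mu0 > 0 \<and>
        (\<forall>x. trajectory Abar Adbar Dbar tau (\<lambda>_. 0) x \<longrightarrow>
          (\<forall>k. V x (k + 1) - V x k \<le> - mu0 * (norm (x (int k)))\<^sup>2))) \<and>
      (let mu = lambda_min (- M) in
        mu > 0 \<and>
        (\<forall>delta x N. bounded (range delta) \<longrightarrow> trajectory Abar Adbar Dbar tau delta x \<longrightarrow>
          (\<Sum>k\<le>N. (norm (x (int k)))\<^sup>2)
            \<le> 1 / mu * (V x 0 + gamma\<^sup>2 * (\<Sum>k\<le>N. (norm (delta k))\<^sup>2))) \<and>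
        (\<forall>x. (\<forall>i\<le>tau. x (- int i) = 0) \<longleftrightarrow> V x 0 = 0) \<and>
        (\<forall>delta x N. bounded (range delta) \<longrightarrow> trajectory Abar Adbar Dbar tau delta x \<longrightarrow>
          (\<forall>i\<le>tau. x (- int i) = 0) \<longrightarrow>
          L2_set (\<lambda>k. norm (x (int k))) {..N}
            \<le> gamma / sqrt mu * L2_set (\<lambda>k. norm (delta k)) {..N})))"
proof -
  define G where "G = Abar ||| Adbar ||| Dbar"
  have M_eq: "M = supply_matrix X Y gamma + transpose G ** X ** G"
    unfolding M G_def by (rule block_matrix_eq_supply)
  have L_eq: "L = (supply_matrix X Y gamma ||| transpose G) /// (G ||| - matrix_inv X)"
    unfolding L G_def by (rule bordered_matrix_eq_supply)
  have iff: "neg_def L \<longleftrightarrow> neg_def M"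
    unfolding L_eq M_eq
    by (rule schur_complement_neg_def[OF X transpose_supply_matrix])
      (use X Y in \<open>simp_all add: pos_def_def\<close>)
  define M0 where "M0 = leading_submatrix M"
  define mu0 where "mu0 = lambda_min (- M0)"
  define mu where "mu = lambda_min (- M)"
  have step: "V x (k + 1) - V x k =
      (x (int k) @@ x (int k - int tau) @@ delta k)
        \<bullet> (M *v (x (int k) @@ x (int k - int tau) @@ delta k)) + gamma\<^sup>2 * (norm (delta k))\<^sup>2"
    if "trajectory Abar Adbar Dbar tau delta x" for x delta k
    unfolding V M_eq G_def by (rule dissipation[OF that])
  have V0: "(\<forall>i\<le>tau. x (- int i) = 0) \<longleftrightarrow> V x 0 = 0" for x
    unfolding V lyapunov_krasovskii_eq_0_iff[OF X Y] ..
  {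
    assume neg: "neg_def M"
    have neg0: "neg_def M0" using neg_def_leading_submatrix(1)[OF neg] by (simp add: M0_def)
    have mu0: "mu0 > 0" and mu: "mu > 0"
      using neg neg0 by (simp_all add: mu0_def mu_def pos_def_lambda_min_pos neg_def_iff_pos_def_uminus)
    have dec0: "V x (k + 1) - V x k \<le> - mu0 * (norm (x (int k)))\<^sup>2"
      if tr: "trajectory Abar Adbar Dbar tau (\<lambda>_. 0) x" for x k
    proof -
      define v where "v = x (int k) @@ x (int k - int tau)"
      have "V x (k + 1) - V x k = v \<bullet> (M0 *v v)"
        using step[OF tr, of k] neg_def_leading_submatrix(2)[OF neg, of v] by (simp add: v_def M0_def)
      also have "\<dots> \<le> - mu0 * (norm v)\<^sup>2"
        unfolding mu0_def by (rule neg_def_form_le[OF neg0])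
      also have "\<dots> \<le> - mu0 * (norm (x (int k)))\<^sup>2"
        using mu0 by (simp add: v_def norm_vec_append)
      finally show ?thesis .
    qed
    have stable: "asymptotically_stable Abar Adbar Dbar tau"
      by (rule asymptotically_stable_if_decrease[OF X Y mu0]) (use dec0 V in simp)
    have energy: "(\<Sum>k\<le>N. (norm (x (int k)))\<^sup>2)
        \<le> 1 / mu * (V x 0 + gamma\<^sup>2 * (\<Sum>k\<le>N. (norm (delta k))\<^sup>2))"
      if tr: "trajectory Abar Adbar Dbar tau delta x" for delta x N
      unfolding V
    proof (rule energy_bound[OF X Y mu])
      fix k
      define v where "v = x (int k) @@ x (int k - int tau) @@ delta k"
      have "v \<bullet> (M *v v) \<le> - mu * (norm v)\<^sup>2"
        unfolding mu_def by (rule neg_def_form_le[OF neg])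
      also have "\<dots> \<le> - mu * (norm (x (int k)))\<^sup>2"
        using mu by (simp add: v_def norm_vec_append)
      finally show "lyapunov_krasovskii X Y tau x (k + 1) - lyapunov_krasovskii X Y tau x k
          \<le> - mu * (norm (x (int k)))\<^sup>2 + gamma\<^sup>2 * (norm (delta k))\<^sup>2"
        using step[OF tr, of k] by (simp add: v_def V)
    qed
    have gain: "L2_set (\<lambda>k. norm (x (int k))) {..N} \<le> gamma / sqrt mu * L2_set (\<lambda>k. norm (delta k)) {..N}"
      if tr: "trajectory Abar Adbar Dbar tau delta x" and "\<forall>i\<le>tau. x (- int i) = 0" for delta x N
    proof -
      have "V x 0 = 0" using that V0 by blast
      hence "(\<Sum>k\<le>N. (norm (x (int k)))\<^sup>2) \<le> gamma\<^sup>2 / mu * (\<Sum>k\<le>N. (norm (delta k))\<^sup>2)"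
        using energy[OF tr, of N] by simp
      hence "sqrt (\<Sum>k\<le>N. (norm (x (int k)))\<^sup>2) \<le> sqrt (gamma\<^sup>2 / mu * (\<Sum>k\<le>N. (norm (delta k))\<^sup>2))"
        by (rule real_sqrt_le_mono)
      thus ?thesis
        using gamma by (simp add: L2_set_def real_sqrt_mult real_sqrt_divide)
    qed
    note stable neg0 mu0 dec0 mu energy gain
  }
  thus ?thesis
    using iff V0 unfolding Let_def M0_def[symmetric] mu0_def[symmetric] mu_def[symmetric] by blast
qed

end
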